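(* Let $m,n>0$ and let $z = l z_\ast$ with integers $l, z_\ast > 1$. Let $H\in\mathbb{F}_2^{mz\times nz}$ be a quasi-cyclic parity-check matrix with circulant size $z$, let $H_\ast = \mathbb{P}_{z\rightarrow z_\ast}H \in \mathbb{F}_2^{mz_\ast\times nz_\ast}$, and let $P_{z\rightarrow z_\ast}:\mathbb{F}_2^{nz}\to\mathbb{F}_2^{nz_\ast}$ be the linear projection of vectors (all defined in the context). Let $x\in\mathbb{F}_2^{nz}$ be a $(w,v)$-TS pseudo-codeword relative to $H$, and suppose that $x_\ast = P_{z\rightarrow z_\ast}x$ is nonzero. Then $x_\ast$ is a $(w',v')$-TS pseudo-codeword relative to $H_\ast$ for some $w',v'$ with $$w'\leqslant w,\qquad v'\leqslant v,\qquad v-v' = 2r',\qquad w-w' = 2r'',\qquad r',r''\in\{0,1,2,\ldots\}.$$ As a consequence, the linear map $P_{z\rightarrow z_\ast}$ maps the linear code $C(H)$ into the code $C(H_\ast)$, i.e. $P_{z\rightarrow z_\ast}(C(H))\subseteq C(H_\ast)$.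
   Context: All indices start from $0$. For $z>0$, $Q=Q_z\in\mathbb{F}_2^{z\times z}$ is the circulant permutation matrix with $Q_{ij}=1$ if $i+1\equiv j \pmod z$ and $Q_{ij}=0$ otherwise, $0\le i,j\le z-1$. By convention the symbol $Q^{-1}$ denotes the zero matrix in $\mathbb{F}_2^{z\times z}$. A quasi-cyclic parity-check matrix $H\in\mathbb{F}_2^{mz\times nz}$ with circulant size $z$ is the block matrix whose $(i,j)$ block is $Q^{a_{ij}}$, $0\le i<m$, $0\le j<n$, where $a_{ij}\in\{-1,0,1,\ldots,z-1\}$. Its exponential matrix is $E(H)=(a_{ij})\in\mathbb{Z}^{m\times n}$. The linear code defined by $H$ is $C(H)=\{x\in\mathbb{F}_2^{nz}: Hx^T=0\}$. For $z=lz_\ast$, the matrix $\mathbb{P}_{z\rightarrow z_\ast}H\in\mathbb{F}_2^{mz_\ast\times nz_\ast}$ is the quasi-cyclic matrix with circulant size $z_\ast$ whose exponential matrix has $(i,j)$ entry $a_{ij}\bmod z_\ast$ if $a_{ij}\geqslant 0$, and $-1$ if $a_{ij}=-1$. The linear map $P_{z\rightarrow z_\ast}:\mathbb{F}_2^{nz}\to\mathbb{F}_2^{nz_\ast}$ sends $x$ to $y$ where, for $0\le j\le nz_\ast-1$, $j=qz_\ast+r$, $0\le r<z_\ast$, $$y_j = x_{qz+r}\oplus x_{qz+r+z_\ast}\oplus\cdots\oplus x_{qz+r+(l-1)z_\ast},$$ with $\oplus$ denoting addition in $\mathbb{F}_2$. For a parity-check matrix $H$ with $N$ columns, a vector $x\in\mathbb{F}_2^{N}$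 is a $(w,v)$-TS (trapping set) pseudo-codeword relative to $H$ if the Hamming weight of $x$ is $w$ and the Hamming weight of $Hx^T$ is $v$, where $w>0$ and $v\geqslant 0$. *)

theory Defs
  imports
    "Jordan_Normal_Form.Matrix"
    "HOL-Library.Z2"
    "HOL-Number_Theory.Cong"
begin

definition circ_perm_mat :: "nat \<Rightarrow> bit mat" where
  "circ_perm_mat z = mat z z (\<lambda>(i, j). if [i + 1 = j] (mod z) then 1 else 0)"

text \<open>The symbol \<open>Q\<^sup>-\<^sup>1\<close> denotes the zero matrix, not the inverse of \<open>Q\<close>.\<close>

definition circ_pow :: "nat \<Rightarrow> int \<Rightarrow> bit mat" where
  "circ_pow z a = (if a = -1 then 0\<^sub>m z z else circ_perm_mat z ^\<^sub>m nat a)"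

definition exponent_mats :: "nat \<Rightarrow> nat \<Rightarrow> nat \<Rightarrow> int mat set" where
  "exponent_mats m n z =
     {E \<in> carrier_mat m n. \<forall>i<m. \<forall>j<n. E $$ (i, j) \<in> {-1..<int z}}"

definition qc_mat :: "nat \<Rightarrow> int mat \<Rightarrow> bit mat" where
  "qc_mat z E = mat (dim_row E * z) (dim_col E * z)
     (\<lambda>(i, j). circ_pow z (E $$ (i div z, j div z)) $$ (i mod z, j mod z))"

definition quasi_cyclic :: "nat \<Rightarrow> nat \<Rightarrow> nat \<Rightarrow> bit mat \<Rightarrow> bool" where
  "quasi_cyclic m n z H \<longleftrightarrow> (\<exists>E \<in> exponent_mats m n z. H = qc_mat z E)"

definition exponential_matrix :: "nat \<Rightarrow> nat \<Rightarrow> nat \<Rightarrow> bit mat \<Rightarrow> int mat" where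
  "exponential_matrix m n z H = (THE E. E \<in> exponent_mats m n z \<and> H = qc_mat z E)"

definition mat_proj :: "nat \<Rightarrow> nat \<Rightarrow> nat \<Rightarrow> nat \<Rightarrow> bit mat \<Rightarrow> bit mat" where
  "mat_proj m n z z' H =
     qc_mat z' (map_mat (\<lambda>a. if a = -1 then -1 else a mod int z') (exponential_matrix m n z H))"

definition vec_proj :: "nat \<Rightarrow> nat \<Rightarrow> nat \<Rightarrow> bit vec \<Rightarrow> bit vec" where
  "vec_proj n z z' x =
     vec (n * z') (\<lambda>j. \<Sum>k<z div z'. x $ ((j div z') * z + j mod z' + k * z'))"

definition linear_code :: "bit mat \<Rightarrow> bit vec set" where
  "linear_code H = {x \<in> carrier_vec (dim_col H). H *\<^sub>v x = 0\<^sub>v (dim_row H)}"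

definition hamming_weight :: "bit vec \<Rightarrow> nat" where
  "hamming_weight x = card {i. i < dim_vec x \<and> x $ i \<noteq> 0}"

definition TS_pseudo_codeword :: "bit mat \<Rightarrow> nat \<Rightarrow> nat \<Rightarrow> bit vec \<Rightarrow> bool" where
  "TS_pseudo_codeword H w v x \<longleftrightarrow>
     x \<in> carrier_vec (dim_col H) \<and> w > 0 \<and>
     hamming_weight x = w \<and> hamming_weight (H *\<^sub>v x) = v"

text \<open>The exponential matrix is determined by \<open>H\<close>, so the description in
  \<^const>\<open>exponential_matrix\<close> denotes.\<close>

lemma circ_pow_mat_index:
  assumes "i < z" "j < z"
  shows "(circ_perm_mat z ^\<^sub>m k) $$ (i, j) = (if (i + k) mod z = j then 1 else 0)"
  using assms(2)
proof (induction k arbitrary: j)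
  case 0
  then show ?case using assms(1) by (auto simp: circ_perm_mat_def)
next
  case (Suc k)
  have carr: "circ_perm_mat z \<in> carrier_mat z z" by (simp add: circ_perm_mat_def)
  have carrk: "circ_perm_mat z ^\<^sub>m k \<in> carrier_mat z z" using carr by simp
  have "(circ_perm_mat z ^\<^sub>m Suc k) $$ (i, j) =
      (\<Sum>t<z. (circ_perm_mat z ^\<^sub>m k) $$ (i, t) * circ_perm_mat z $$ (t, j))"
    using carr carrk assms(1) Suc.prems
    by (auto simp: scalar_prod_def atLeast0LessThan intro!: sum.cong)
  also have "\<dots> = (\<Sum>t<z. if t = (i + k) mod z then circ_perm_mat z $$ (t, j) else 0)"
    using Suc.IH by (intro sum.cong) auto
  also have "\<dots> = circ_perm_mat z $$ ((i + k) mod z, j)"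
    using assms(1) by simp
  also have "\<dots> = (if (i + Suc k) mod z = j then 1 else 0)"
    using assms(1) Suc.prems
    by (simp add: circ_perm_mat_def cong_def mod_Suc_eq)
  finally show ?case .
qed

lemma circ_pow_inj:
  assumes "a \<in> {-1..<int z}" "b \<in> {-1..<int z}" "z > 0"
    and eq: "\<And>j. j < z \<Longrightarrow> circ_pow z a $$ (0, j) = circ_pow z b $$ (0, j)"
  shows "a = b"
proof -
  have entry: "circ_pow z c $$ (0, j) = (if c = int j then 1 else 0)"
    if "c \<in> {-1..<int z}" "j < z" for c j
  proof (cases "c = -1")
    case False
    then have "nat c < z" "c \<ge> 0" using that by auto
    then show ?thesis
      using False that assms(3) by (auto simp: circ_pow_def circ_pow_mat_index)
  qed (use that in \<open>simp add: circ_pow_def\<close>)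
  have *: "c = d" if cd: "c \<in> {-1..<int z}" "d \<in> {-1..<int z}" "c \<noteq> -1"
    "\<And>j. j < z \<Longrightarrow> circ_pow z c $$ (0, j) = circ_pow z d $$ (0, j)" for c d
  proof -
    have "nat c < z" "int (nat c) = c" using cd by auto
    then show ?thesis
      using cd(4)[of "nat c"] entry[OF cd(1), of "nat c"] entry[OF cd(2), of "nat c"]
      by (auto split: if_splits)
  qed
  show ?thesis
    using *[OF assms(1,2) _ eq] *[OF assms(2,1) _ eq[symmetric]] by metis
qed

lemma exponent_mat_unique:
  assumes E: "E \<in> exponent_mats m n z" and F: "F \<in> exponent_mats m n z"
    and z: "z > 0" and eq: "qc_mat z E = qc_mat z F"
  shows "E = F"
proof (rule eq_matI)
  fix i j assume "i < dim_row F" "j < dim_col F"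
  then have ij: "i < m" "j < n" using F by (auto simp: exponent_mats_def)
  show "E $$ (i, j) = F $$ (i, j)"
  proof (rule circ_pow_inj[OF _ _ z])
    fix k assume k: "k < z"
    have "i * z < m * z" using ij z by simp
    moreover have "j * z + k < n * z"
      using ij k by (metis add.commute add_less_cancel_left less_le_trans mult_Suc
          mult_le_mono1 Suc_leI)
    moreover have "qc_mat z E $$ (i * z, j * z + k) = qc_mat z F $$ (i * z, j * z + k)"
      by (simp add: eq)
    ultimately show "circ_pow z (E $$ (i, j)) $$ (0, k) = circ_pow z (F $$ (i, j)) $$ (0, k)"
      using E F k z by (auto simp: qc_mat_def exponent_mats_def)
  qed (use E F ij in \<open>auto simp: exponent_mats_def\<close>)
qed (use E F in \<open>auto simp: exponent_mats_def\<close>)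

lemma exponential_matrix_qc_mat:
  assumes "E \<in> exponent_mats m n z" "z > 0"
  shows "exponential_matrix m n z (qc_mat z E) = E"
  unfolding exponential_matrix_def
  using assms exponent_mat_unique by (intro the_equality) auto

text \<open>Over the two-element field, additivity is linearity.\<close>

lemma vec_proj_add:
  assumes "x \<in> carrier_vec (n * z)" "y \<in> carrier_vec (n * z)" and z: "z = l * z'"
  shows "vec_proj n z z' (x + y) = vec_proj n z z' x + vec_proj n z z' y"
proof (rule eq_vecI)
  fix j assume "j < dim_vec (vec_proj n z z' x + vec_proj n z z' y)"
  then have j: "j < n * z'" by (simp add: vec_proj_def)
  then have z': "z' > 0" by (cases z') auto
  have q: "j div z' < n" using j z' by (simp add: less_mult_imp_div_less)
  have "j div z' * z + j mod z' + k * z' < n * z" if k: "k < z div z'" for k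
  proof -
    have "k < l" using k z z' by simp
    then have "Suc k * z' \<le> z" using mult_le_mono1[of "Suc k" l z'] z by simp
    moreover have "j mod z' < z'" using z' by simp
    moreover have "Suc (j div z') * z \<le> n * z" using q by (intro mult_le_mono1) simp
    ultimately show ?thesis by simp
  qed
  then have "(\<Sum>k<z div z'. (x + y) $ (j div z' * z + j mod z' + k * z')) =
      (\<Sum>k<z div z'. x $ (j div z' * z + j mod z' + k * z') + y $ (j div z' * z + j mod z' + k * z'))"
    using assms(1,2) by (intro sum.cong[OF refl] index_add_vec(1)) auto
  then show "vec_proj n z z' (x + y) $ j = (vec_proj n z z' x + vec_proj n z z' y) $ j"
    using j by (simp only: vec_proj_def index_vec index_add_vec dim_vec sum.distrib)
qed (simp add: vec_proj_def)

end

(* The projection intertwines the two parity-check matrices, P (H x) = H' (P x), because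
   adding up the entries of a residue class modulo z' absorbs the reduction of exponents modulo z'.
   Moreover each entry of P y is the parity of the weight of y on a fibre, so that the weight
   drops by an even amount; this applies both to x and to the syndrome H x. *)

theory Submission
  imports Defs
begin

section \<open>Reindexing sums over blocks, fibres and residue classes\<close>

lemma sum_lessThan_mult:
  fixes f :: "nat \<Rightarrow> 'a::comm_monoid_add"
  shows "(\<Sum>i<n * k. f i) = (\<Sum>q<n. \<Sum>r<k. f (q * k + r))"
proof -
  have "(\<Sum>i<n * k. f i) = (\<Sum>q<n. sum f {q * k..<q * k + k})"
    by (rule sum.nat_group[symmetric])
  also have "\<dots> = (\<Sum>q<n. \<Sum>r<k. f (q * k + r))"
  proof (rule sum.cong[OF refl])
    fix q
    show "sum f {q * k..<q * k + k} = (\<Sum>r<k. f (q * k + r))"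
      using sum.shift_bounds_nat_ivl[of f 0 "q * k" k]
      by (simp add: atLeast0LessThan add.commute)
  qed
  finally show ?thesis .
qed

text \<open>Write a coordinate as \<open>q * (l * d) + k * d + r\<close> with \<open>k < l\<close>
  and \<open>r < d\<close>. For fixed \<open>q\<close> and \<open>r\<close> these are exactly the
  coordinates that the projection adds into entry \<open>q * d + r\<close>, so interchanging the
  sums over \<open>k\<close> and \<open>r\<close> groups them by fibre.\<close>

lemma sum_lessThan_fibres:
  fixes f :: "nat \<Rightarrow> 'a::comm_monoid_add"
  shows "(\<Sum>i<n * (l * d). f i) = (\<Sum>j<n * d. \<Sum>k<l. f (j div d * (l * d) + j mod d + k * d))"
proof -
  have "(\<Sum>i<n * (l * d). f i) = (\<Sum>q<n. \<Sum>k<l. \<Sum>r<d. f (q * (l * d) + (k * d + r)))"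
    by (simp add: sum_lessThan_mult)
  also have "\<dots> = (\<Sum>q<n. \<Sum>r<d. \<Sum>k<l. f (q * (l * d) + (k * d + r)))"
    by (intro sum.cong refl sum.swap)
  \<comment> \<open>Since \<open>r < d\<close>, the pair is recovered from \<open>q * d + r\<close>
    as quotient and remainder, and so merges into one index.\<close>
  also have "\<dots> = (\<Sum>q<n. \<Sum>r<d. \<Sum>k<l.
      f ((q * d + r) div d * (l * d) + (q * d + r) mod d + k * d))"
    by (intro sum.cong refl) (simp add: ac_simps)
  also have "\<dots> = (\<Sum>j<n * d. \<Sum>k<l. f (j div d * (l * d) + j mod d + k * d))"
    by (rule sum_lessThan_mult[symmetric])
  finally show ?thesis .
qed

text \<open>Translation by \<open>t\<close> permutes the residues modulo \<open>l\<close>.\<close>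

lemma sum_lessThan_rotate:
  fixes f :: "nat \<Rightarrow> 'a::comm_monoid_add"
  assumes "l > 0"
  shows "(\<Sum>k<l. f ((t + k) mod l)) = (\<Sum>k<l. f k)"
proof -
  have inj: "inj_on (\<lambda>k. (t + k) mod l) {..<l}"
  proof (rule inj_onI)
    fix a b assume ab: "a \<in> {..<l}" "b \<in> {..<l}" "(t + a) mod l = (t + b) mod l"
    then have "[t + a = t + b] (mod l)" by (simp add: cong_def)
    then have "[a = b] (mod l)" by (simp add: cong_add_lcancel_nat)
    with ab show "a = b" by (simp add: cong_def)
  qed
  then have "(\<lambda>k. (t + k) mod l) ` {..<l} = {..<l}"
    using assms by (intro endo_inj_surj) auto
  then show ?thesis
    using sum.reindex[OF inj, of f] by simp
qed

text \<open>Modulo \<open>l * d\<close> the indices \<open>s + k * d\<close> run through a coset of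
  the multiples of \<open>d\<close>. The coset depends on \<open>s mod d\<close> alone; the quotient
  \<open>s div d\<close> merely rotates the parameter \<open>k\<close>.\<close>

lemma sum_residue_class:
  fixes f :: "nat \<Rightarrow> 'a::comm_monoid_add"
  assumes "l > 0" "d > 0"
  shows "(\<Sum>k<l. f ((s + k * d) mod (l * d))) = (\<Sum>k<l. f (s mod d + k * d))"
proof -
  have "(s + k * d) mod (l * d) = s mod d + (s div d + k) mod l * d" for k
  proof -
    have "(s + k * d) mod (d * l) = d * ((s + k * d) div d mod l) + (s + k * d) mod d"
      by (rule mod_mult2_eq)
    then show ?thesis using assms by (simp add: ac_simps)
  qed
  then show ?thesis
    using sum_lessThan_rotate[OF assms(1), of "\<lambda>k. f (s mod d + k * d)" "s div d"] by simp
qed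

section \<open>Syndromes and their projections\<close>

lemma dim_qc_mat [simp]:
  "dim_row (qc_mat z E) = dim_row E * z" "dim_col (qc_mat z E) = dim_col E * z"
  by (simp_all add: qc_mat_def)

lemma dim_vec_proj [simp]: "dim_vec (vec_proj n z z' x) = n * z'"
  by (simp add: vec_proj_def)

text \<open>Each row of a power of the circulant holds a single one, in the column reached by
  shifting the row cyclically by the exponent. Hence every nonzero block selects one entry of
  \<open>x\<close>.\<close>

lemma qc_mat_mult_vec_index:
  assumes z: "z > 0" and x: "x \<in> carrier_vec (dim_col E * z)" and i: "i < dim_row E * z"
  shows "(qc_mat z E *\<^sub>v x) $ i =
    (\<Sum>q<dim_col E. if E $$ (i div z, q) = -1 then 0
      else x $ (q * z + (i mod z + nat (E $$ (i div z, q))) mod z))"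
proof -
  have lt: "q * z + r < dim_col E * z" if "q < dim_col E" "r < z" for q r
  proof -
    have "Suc q * z \<le> dim_col E * z" using that by (intro mult_le_mono1) simp
    with that show ?thesis by simp
  qed
  have "(qc_mat z E *\<^sub>v x) $ i = (\<Sum>j<dim_col E * z. qc_mat z E $$ (i, j) * x $ j)"
    using x i by (auto simp: scalar_prod_def atLeast0LessThan intro!: sum.cong)
  also have "\<dots> = (\<Sum>q<dim_col E. \<Sum>r<z. qc_mat z E $$ (i, q * z + r) * x $ (q * z + r))"
    by (rule sum_lessThan_mult)
  also have "\<dots> = (\<Sum>q<dim_col E. if E $$ (i div z, q) = -1 then 0
      else x $ (q * z + (i mod z + nat (E $$ (i div z, q))) mod z))"
  proof (rule sum.cong[OF refl])
    fix q assume q: "q \<in> {..<dim_col E}"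
    let ?a = "E $$ (i div z, q)"
    have entry: "qc_mat z E $$ (i, q * z + r) = circ_pow z ?a $$ (i mod z, r)" if "r < z" for r
      using lt[of q r] that q i by (simp add: qc_mat_def)
    have "(\<Sum>r<z. qc_mat z E $$ (i, q * z + r) * x $ (q * z + r)) =
        (\<Sum>r<z. if r = (i mod z + nat ?a) mod z then if ?a = -1 then 0 else x $ (q * z + r) else 0)"
      using z by (intro sum.cong) (auto simp: entry circ_pow_def circ_pow_mat_index)
    also have "\<dots> = (if ?a = -1 then 0 else x $ (q * z + (i mod z + nat ?a) mod z))"
      using z by simp
    finally show "(\<Sum>r<z. qc_mat z E $$ (i, q * z + r) * x $ (q * z + r)) = \<dots>" .
  qed
  finally show ?thesis .
qed

lemma vec_proj_index:
  assumes "d > 0" "j < n * d"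
  shows "vec_proj n (l * d) d x $ j = (\<Sum>k<l. x $ (j div d * (l * d) + j mod d + k * d))"
  using assms by (simp add: vec_proj_def)

lemma fibre_index_less:
  fixes j k l d n :: nat
  assumes "d > 0" "j < n * d" "k < l"
  shows "j mod d + k * d < l * d" "j div d * (l * d) + j mod d + k * d < n * (l * d)"
proof -
  have "Suc k * d \<le> l * d" using assms by (intro mult_le_mono1) simp
  moreover have "j mod d < d" using assms by simp
  ultimately show *: "j mod d + k * d < l * d" by simp
  have "j div d < n" using assms by (simp add: less_mult_imp_div_less)
  then have "Suc (j div d) * (l * d) \<le> n * (l * d)" by (intro mult_le_mono1) simp
  with * show "j div d * (l * d) + j mod d + k * d < n * (l * d)" by simp
qed

text \<open>In each block column, the \<open>l\<close> rows over a projected row select entries of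
  \<open>x\<close> that fill one residue class modulo \<open>d\<close>. Their sum is an entry of the
  projected vector, at a place that depends on the exponent only modulo \<open>d\<close>.\<close>

lemma vec_proj_qc_mat_mult:
  fixes E d
  defines "E' \<equiv> map_mat (\<lambda>a. if a = -1 then -1 else a mod int d) E"
  assumes l: "l > 0" and d: "d > 0"
    and E: "\<And>i j. i < dim_row E \<Longrightarrow> j < dim_col E \<Longrightarrow> E $$ (i, j) \<ge> -1"
    and x: "x \<in> carrier_vec (dim_col E * (l * d))"
  shows "vec_proj (dim_row E) (l * d) d (qc_mat (l * d) E *\<^sub>v x) =
    qc_mat d E' *\<^sub>v vec_proj (dim_col E) (l * d) d x"
proof (rule eq_vecI)
  fix i assume "i < dim_vec (qc_mat d E' *\<^sub>v vec_proj (dim_col E) (l * d) d x)"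
  then have i: "i < dim_row E * d" by (simp add: E'_def)
  define p where "p = i div d"
  define r where "r = i mod d"
  have p: "p < dim_row E" using i by (simp add: p_def less_mult_imp_div_less)
  let ?a = "\<lambda>q. E $$ (p, q)"
  let ?b = "\<lambda>q. E' $$ (p, q)"
  have ld: "l * d > 0" using l d by simp
  have b: "?b q = (if ?a q = -1 then -1 else ?a q mod int d)" if "q < dim_col E" for q
    using p that by (simp add: E'_def)
  \<comment> \<open>Remainders modulo \<open>d\<close> are nonnegative, so reduction never produces
    the value \<open>-1\<close> reserved for the zero block.\<close>
  have b_iff: "?b q = -1 \<longleftrightarrow> ?a q = -1" if "q < dim_col E" for q
    using b[OF that] d by (metis pos_mod_sign of_nat_0_less_iff neg_0_le_iff_le not_one_le_zero)
  have lt: "q * d + s < dim_col E * d" if "q < dim_col E" "s < d" for q s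
  proof -
    have "Suc q * d \<le> dim_col E * d" using that by (intro mult_le_mono1) simp
    with that show ?thesis by simp
  qed
  have "vec_proj (dim_row E) (l * d) d (qc_mat (l * d) E *\<^sub>v x) $ i =
      (\<Sum>k<l. (qc_mat (l * d) E *\<^sub>v x) $ (p * (l * d) + r + k * d))"
    using d i by (simp add: vec_proj_index p_def r_def)
  also have "\<dots> = (\<Sum>k<l. \<Sum>q<dim_col E. if ?a q = -1 then 0
      else x $ (q * (l * d) + ((r + nat (?a q)) + k * d) mod (l * d)))"
  proof (rule sum.cong[OF refl])
    fix k assume "k \<in> {..<l}"
    then have k: "k < l" by simp
    have lt': "p * (l * d) + r + k * d < dim_row E * (l * d)" and s: "r + k * d < l * d"
      using fibre_index_less[OF d i k] by (simp_all add: p_def r_def)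
    \<comment> \<open>The \<open>l\<close> rows over \<open>i\<close> all lie in block row
      \<open>p\<close>, at the offsets \<open>r + k * d\<close>.\<close>
    have "(p * (l * d) + r + k * d) div (l * d) = p" "(p * (l * d) + r + k * d) mod (l * d) = r + k * d"
      using s ld by (simp_all add: add.assoc)
    moreover have "r + k * d + nat (?a q) = r + nat (?a q) + k * d" for q by simp
    ultimately show "(qc_mat (l * d) E *\<^sub>v x) $ (p * (l * d) + r + k * d) =
        (\<Sum>q<dim_col E. if ?a q = -1 then 0
          else x $ (q * (l * d) + ((r + nat (?a q)) + k * d) mod (l * d)))"
      by (simp only: qc_mat_mult_vec_index[OF ld x lt'])
  qed
  \<comment> \<open>After the interchange each block column can be treated alone, its inner sum
    running over a residue class.\<close>
  also have "\<dots> = (\<Sum>q<dim_col E. \<Sum>k<l. if ?a q = -1 then 0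
      else x $ (q * (l * d) + ((r + nat (?a q)) + k * d) mod (l * d)))"
    by (rule sum.swap)
  also have "\<dots> = (\<Sum>q<dim_col E. if ?b q = -1 then 0
      else vec_proj (dim_col E) (l * d) d x $ (q * d + (r + nat (?b q)) mod d))"
  proof (rule sum.cong[OF refl])
    fix q assume "q \<in> {..<dim_col E}"
    then have q: "q < dim_col E" by simp
    show "(\<Sum>k<l. if ?a q = -1 then 0
          else x $ (q * (l * d) + ((r + nat (?a q)) + k * d) mod (l * d))) =
        (if ?b q = -1 then 0
          else vec_proj (dim_col E) (l * d) d x $ (q * d + (r + nat (?b q)) mod d))"
    proof (cases "?a q = -1")
      case True
      then show ?thesis using b_iff[OF q] by simp
    next
      case False
      \<comment> \<open>Nonnegativity lets \<open>nat\<close> commute with reduction modulo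
        \<open>d\<close>.\<close>
      then have "?a q \<ge> 0" using E[OF p q] by simp
      then have "nat (?b q) = nat (?a q) mod d" using b[OF q] False by (simp add: nat_mod_distrib)
      then have "(r + nat (?b q)) mod d = (r + nat (?a q)) mod d" by (simp add: mod_add_right_eq)
      then show ?thesis
        using False b_iff[OF q] d lt[OF q, of "(r + nat (?a q)) mod d"]
          sum_residue_class[OF l d, of "\<lambda>u. x $ (q * (l * d) + u)" "r + nat (?a q)"]
        by (simp add: vec_proj_index add.assoc)
    qed
  qed
  also have "\<dots> = (qc_mat d E' *\<^sub>v vec_proj (dim_col E) (l * d) d x) $ i"
  proof -
    have "dim_row E' = dim_row E" "dim_col E' = dim_col E" by (simp_all add: E'_def)
    moreover have "vec_proj (dim_col E) (l * d) d x \<in> carrier_vec (dim_col E * d)"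
      by (rule carrier_vecI) simp
    ultimately show ?thesis
      using qc_mat_mult_vec_index[OF d, of "vec_proj (dim_col E) (l * d) d x" E' i] i
      by (simp only: p_def r_def)
  qed
  finally show "vec_proj (dim_row E) (l * d) d (qc_mat (l * d) E *\<^sub>v x) $ i = \<dots>" .
qed (simp add: E'_def)

section \<open>Hamming weights and parity\<close>

lemma bit_sum_eq: "(\<Sum>k\<in>A. f k :: bit) = of_bool (odd (\<Sum>k\<in>A. of_bool (f k \<noteq> 0) :: nat))"
  \<comment> \<open>For infinite \<open>A\<close> both sums default to 0, which is even.\<close>
  by (induction A rule: infinite_finite_induct) (auto simp: of_bool_def)

lemma hamming_weight_eq_sum: "hamming_weight x = (\<Sum>i<dim_vec x. of_bool (x $ i \<noteq> 0))"
proof -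
  have "{i. i < dim_vec x \<and> x $ i \<noteq> 0} = {..<dim_vec x} \<inter> {i. x $ i \<noteq> 0}" by auto
  then show ?thesis by (simp add: hamming_weight_def)
qed

text \<open>With \<open>c j\<close> the weight of \<open>x\<close> on fibre \<open>j\<close>, the
  projection keeps \<open>c j mod 2\<close> of it. The witness is the sum of the
  \<open>c j div 2\<close>, the number of cancelling pairs of ones.\<close>

lemma hamming_weight_vec_proj:
  assumes d: "d > 0" and x: "x \<in> carrier_vec (n * (l * d))"
  shows "\<exists>r. hamming_weight x = hamming_weight (vec_proj n (l * d) d x) + 2 * r"
proof -
  define c :: "nat \<Rightarrow> nat" where
    "c j = (\<Sum>k<l. of_bool (x $ (j div d * (l * d) + j mod d + k * d) \<noteq> 0))" for j
  have "vec_proj n (l * d) d x $ j = of_bool (odd (c j))" if "j < n * d" for j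
    unfolding vec_proj_index[OF d that] c_def by (rule bit_sum_eq)
  then have "hamming_weight (vec_proj n (l * d) d x) = (\<Sum>j<n * d. c j mod 2)"
    unfolding hamming_weight_eq_sum dim_vec_proj
    by (intro sum.cong) (auto simp: of_bool_def odd_iff_mod_2_eq_one)
  moreover have "hamming_weight x = (\<Sum>j<n * d. c j)"
    unfolding hamming_weight_eq_sum carrier_vecD[OF x] c_def by (rule sum_lessThan_fibres)
  moreover have "(\<Sum>j<n * d. c j) = (\<Sum>j<n * d. c j mod 2) + 2 * (\<Sum>j<n * d. c j div 2)"
    unfolding sum_distrib_left sum.distrib[symmetric] by (intro sum.cong) auto
  ultimately show ?thesis by metis
qed

lemma hamming_weight_eq_0_iff: "hamming_weight x = 0 \<longleftrightarrow> x = 0\<^sub>v (dim_vec x)"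
proof -
  have "hamming_weight x = 0 \<longleftrightarrow> (\<forall>i<dim_vec x. x $ i = 0)"
    unfolding hamming_weight_eq_sum by (subst sum_eq_0_iff) auto
  then show ?thesis by (auto simp: vec_eq_iff)
qed

lemma vec_proj_zero:
  assumes "d > 0"
  shows "vec_proj n (l * d) d (0\<^sub>v (n * (l * d))) = 0\<^sub>v (n * d)"
  using assms fibre_index_less(2)[OF assms] by (intro eq_vecI) (auto simp: vec_proj_index)

section \<open>Trapping sets and codewords under the projection\<close>

theorem theorem1:
  fixes m n z l z\<^sub>s :: nat and H :: "bit mat"
  assumes "m > 0" and "n > 0" and "l > 1" and "z\<^sub>s > 1" and "z = l * z\<^sub>s"
    and "quasi_cyclic m n z H"
  shows "(\<forall>x w v. TS_pseudo_codeword H w v x \<and> vec_proj n z z\<^sub>s x \<noteq> 0\<^sub>v (n * z\<^sub>s) \<longrightarrow>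
            (\<exists>w' v'. TS_pseudo_codeword (mat_proj m n z z\<^sub>s H) w' v' (vec_proj n z z\<^sub>s x) \<and>
               w' \<le> w \<and> v' \<le> v \<and>
               (\<exists>r' :: nat. int v - int v' = 2 * int r') \<and>
               (\<exists>r'' :: nat. int w - int w' = 2 * int r''))) \<and>
         vec_proj n z z\<^sub>s ` linear_code H \<subseteq> linear_code (mat_proj m n z z\<^sub>s H)"
proof -
  obtain E where E: "E \<in> exponent_mats m n z" and H: "H = qc_mat z E"
    using assms(6) by (auto simp: quasi_cyclic_def)
  let ?P = "vec_proj n z z\<^sub>s" and ?H' = "mat_proj m n z z\<^sub>s H"
  have pos: "l > 0" "z\<^sub>s > 0" "z > 0" using assms by simp_all
  have dims: "dim_row E = m" "dim_col E = n" using E by (auto simp: exponent_mats_def)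
  have dimH: "dim_row H = m * z" "dim_col H = n * z" by (simp_all add: H dims)
  \<comment> \<open>By uniqueness of exponents, the matrix that \<open>mat_proj\<close> reduces is
    the chosen \<open>E\<close>.\<close>
  have H': "?H' = qc_mat z\<^sub>s (map_mat (\<lambda>a. if a = -1 then -1 else a mod int z\<^sub>s) E)"
    by (simp add: mat_proj_def H exponential_matrix_qc_mat[OF E pos(3)])
  have dimH': "dim_row ?H' = m * z\<^sub>s" "dim_col ?H' = n * z\<^sub>s" by (simp_all add: H' dims)
  have comm: "?H' *\<^sub>v ?P x = vec_proj m z z\<^sub>s (H *\<^sub>v x)" if "x \<in> carrier_vec (n * z)" for x
  proof -
    have "E $$ (i, j) \<ge> -1" if "i < dim_row E" "j < dim_col E" for i j
      using E that dims by (simp add: exponent_mats_def)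
    moreover have "x \<in> carrier_vec (dim_col E * (l * z\<^sub>s))" using that by (simp add: dims assms(5))
    ultimately have "vec_proj (dim_row E) (l * z\<^sub>s) z\<^sub>s (qc_mat (l * z\<^sub>s) E *\<^sub>v x) =
        qc_mat z\<^sub>s (map_mat (\<lambda>a. if a = -1 then -1 else a mod int z\<^sub>s) E) *\<^sub>v
          vec_proj (dim_col E) (l * z\<^sub>s) z\<^sub>s x"
      by (rule vec_proj_qc_mat_mult[OF pos(1,2)])
    then show ?thesis unfolding H' by (simp only: dims assms(5)[symmetric] H)
  qed
  have P_carrier: "?P x \<in> carrier_vec (dim_col ?H')" for x
    by (rule carrier_vecI) (simp only: dim_vec_proj dimH')
  have "\<exists>w' v'. TS_pseudo_codeword ?H' w' v' (?P x) \<and> w' \<le> w \<and> v' \<le> v \<and>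
      (\<exists>r' :: nat. int v - int v' = 2 * int r') \<and> (\<exists>r'' :: nat. int w - int w' = 2 * int r'')"
    if TS: "TS_pseudo_codeword H w v x" and nz: "?P x \<noteq> 0\<^sub>v (n * z\<^sub>s)" for x w v
  proof -
    have x: "x \<in> carrier_vec (n * z)" and w: "hamming_weight x = w"
      and v: "hamming_weight (H *\<^sub>v x) = v"
      using TS by (simp_all add: TS_pseudo_codeword_def dimH)
    have Hx: "H *\<^sub>v x \<in> carrier_vec (m * z)" by (rule carrier_vecI) (simp only: dim_mult_mat_vec dimH)
    obtain r'' where r'': "w = hamming_weight (?P x) + 2 * r''"
      using hamming_weight_vec_proj[OF pos(2), of x n l, folded assms(5), OF x] unfolding w by blast
    \<comment> \<open>By \<open>comm\<close>, the syndrome of \<open>?P x\<close> is the projected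
      syndrome, which has \<open>m\<close> blocks instead of \<open>n\<close>.\<close>
    obtain r' where r': "v = hamming_weight (?H' *\<^sub>v ?P x) + 2 * r'"
      using hamming_weight_vec_proj[OF pos(2), of "H *\<^sub>v x" m l, folded assms(5), OF Hx]
      unfolding v comm[OF x] by blast
    \<comment> \<open>The assumption \<open>nz\<close> supplies the positive weight demanded of a
      pseudo-codeword.\<close>
    have "TS_pseudo_codeword ?H' (hamming_weight (?P x)) (hamming_weight (?H' *\<^sub>v ?P x)) (?P x)"
      using nz hamming_weight_eq_0_iff[of "?P x"] P_carrier[of x]
      unfolding TS_pseudo_codeword_def dim_vec_proj by (metis gr0I)
    with r' r'' show ?thesis
      by (intro exI[of _ "hamming_weight (?P x)"] exI[of _ "hamming_weight (?H' *\<^sub>v ?P x)"]) auto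
  qed
  \<comment> \<open>A zero syndrome projects to zero, so \<open>comm\<close> gives the inclusion of
    codes, with the zero codeword included.\<close>
  moreover have "?P x \<in> linear_code ?H'" if "x \<in> linear_code H" for x
    using that comm[of x] vec_proj_zero[OF pos(2), of m l, folded assms(5)] P_carrier[of x]
    unfolding linear_code_def dimH dimH' by simp
  ultimately show ?thesis by blast
qed

end
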